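(* Let $D=(D_T,D_F)$ be an $(s^{n-k}:s^p)$ RME design. If $D_T$ has minimum aberration (MA) among all regular $s^{n-k}$ designs and $D$ has MA with respect to $W_{\mathrm{scf}}$, then $D$ has MA with respect to both $W_1$ and $W_2$. If, in addition, for some constant $0\le\alpha<3$ the quantity $\alpha A_{3,0}+A_{2,1}$ is minimized by $D$ (among all $(s^{n-k}:s^p)$ RME designs), then $D$ has MA with respect to $W_{\mathrm{cc}}$.
   Context: Let $s$ be a prime power, $GF(s)$ the field with $s$ elements, and $V_m$ the space of row vectors of length $m$ over $GF(s)$. Let $n,k,p$ be integers with $n\ge1$, $k\ge0$, $n-k\ge 1$, $p\ge 1$; write $N=s^{n-k}$ and $L_q=(s^q-1)/(s-1)$. Designs. A regular $s^{n-k}$ design is the $N\times n$ matrix $D_T$ whose rows are the vectors $uT$, $u\in V_{n-k}$, where $T$ is an $(n-k)\times n$ matrix over $GF(s)$ of full row rank. A regular $(s^{n-k}:s^p)$ design $D$ is specified by such a $T$ together with an $(n-k)\times p$ matrix $B$ over $GF(s)$ of full column rank; its blocks are the sets $\{uT: u\in V_{n-k},\,uB=v\}$, one for each $v\in V_p$. If $b_1,\dots,b_p$ are the columns of $B$, let $F$ be the $(n-k)\times L_p$ matrix whose columns are all combinations $\lambda_1b_1+\cdots+\lambda_pb_p$ with $\lambda_i\in GF(s)$, not all zero, the first nonzero $\lambda_i$ being $1$. Let $D_F$ be the $N\times L_p$ matrix with rows $uF$, $u\in V_{n-k}$ (same ordering of $u$ as in $D_T$). One writes $D=(D_T,D_F)$.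 Wordlength patterns. Let $wt$ denote the Hamming weight. $A_{i,0}=(s-1)^{-1}\#\{w\in V_n: Tw'=0,\ wt(w)=i\}$ and $A_{i,1}=(s-1)^{-1}\#\{(w_1,w_2)\in V_n\times V_{L_p}: Tw_1'+Fw_2'=0,\ wt(w_1)=i,\ wt(w_2)=1\}$ (both are $0$ for $i>n$). $D$ is a regular main effect (RME) design if $A_{1,0}(D)=A_{2,0}(D)=A_{1,1}(D)=0$. Minimum aberration. A regular $s^{n-k}$ design has MA among a class of regular $s^{n-k}$ designs if it sequentially (lexicographically) minimizes $A_{1,0},A_{2,0},\dots,A_{n,0}$ over the class. For blocked designs, consider the sequences $W_{\mathrm{scf}}=(A_{3,0},A_{2,1},A_{4,0},A_{3,1},A_{5,0},A_{4,1},\dots)$ (successive pairs $A_{i+1,0},A_{i,1}$, $i=2,3,\dots$); $W_{\mathrm{cc}}=(3A_{3,0}+A_{2,1},A_{4,0},10A_{5,0}+A_{3,1},A_{6,0},\dots)$ (successive pairs $\binom{2i-1}{i}A_{2i-1,0}+A_{i,1},\ A_{2i,0}$, $i=2,3,\dots$); $W_1=(A_{3,0},A_{4,0},A_{2,1},A_{5,0},A_{6,0},A_{3,1},\dots)$ (successive triples $A_{2i-1,0},A_{2i,0},A_{i,1}$, $i=2,3,\dots$); $W_2=(A_{3,0},A_{2,1},A_{4,0},A_{5,0},A_{3,1},A_{6,0},\dots)$ (successive triples $A_{2i-1,0},A_{i,1},A_{2i,0}$, $i=2,3,\dots$). An $(s^{n-k}:s^p)$ RME design has MA with respect to one of these sequences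 $W$ if it lexicographically minimizes $W$ among all $(s^{n-k}:s^p)$ RME designs (same $s,n,k,p$). *)

theory Defs
  imports
    Complex_Main
    "HOL-Library.Cardinality"
    "HOL-Library.Fun_Lexorder"
    "Jordan_Normal_Form.Matrix"
    "Jordan_Normal_Form.DL_Rank"
begin

text \<open>
  \<open>GF(s)\<close> is a finite field type \<open>'a\<close>, with \<open>s = CARD('a)\<close>; the space \<open>V\<^sub>m\<close> is
  \<open>carrier_vec m\<close>. JNF vectors carry no row/column orientation, so the row vector \<open>uT\<close> is
  \<^term>\<open>transpose_mat T *\<^sub>v u\<close>, and \<open>Tw'\<close> is \<^term>\<open>T *\<^sub>v w\<close>.

  The rows of \<open>D\<^sub>T\<close> are indexed by \<open>u\<close> itself instead of by an enumeration of \<open>V\<^bsub>n-k\<^esub>\<close>.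
\<close>

definition design_matrix :: "'a::field mat \<Rightarrow> 'a vec \<Rightarrow> 'a vec" where
  "design_matrix T = restrict (\<lambda>u. transpose_mat T *\<^sub>v u) (carrier_vec (dim_row T))"

text \<open>
  A design matrix determines its generator matrix. Below, a regular design is therefore
  represented by \<open>T\<close>, and a blocked regular design, with blocks \<open>{uT | u. uB = v}\<close>, by the
  pair \<open>(T, B)\<close> that specifies it.
\<close>

lemma design_matrix_inj:
  fixes T T' :: "'a::field mat"
  assumes T: "T \<in> carrier_mat m n" and T': "T' \<in> carrier_mat m n"
    and eq: "design_matrix T = design_matrix T'"
  shows "T = T'"
proof (rule eq_matI)
  show "dim_row T = dim_row T'" "dim_col T = dim_col T'" using T T' by auto
  fix i j assume "i < dim_row T'" "j < dim_col T'"
  with T' have ij: "i < m" "j < n" by auto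
  have row: "(transpose_mat S *\<^sub>v unit_vec m i) $ j = S $$ (i, j)"
    if "S \<in> carrier_mat m n" for S :: "'a mat"
    using that ij by (auto simp: scalar_prod_right_unit)
  have "design_matrix T (unit_vec m i) = design_matrix T' (unit_vec m i)" by (simp add: eq)
  then have "transpose_mat T *\<^sub>v unit_vec m i = transpose_mat T' *\<^sub>v unit_vec m i"
    using T T' by (auto simp: design_matrix_def)
  then show "T $$ (i, j) = T' $$ (i, j)" using row[OF T] row[OF T'] by simp
qed

definition regular_designs :: "nat \<Rightarrow> nat \<Rightarrow> 'a::field mat set" where
  "regular_designs n k = {T \<in> carrier_mat (n - k) n. vec_space.rank (n - k) T = n - k}"

definition blocked_designs :: "nat \<Rightarrow> nat \<Rightarrow> nat \<Rightarrow> ('a::field mat \<times> 'a mat) set" where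
  "blocked_designs n k p =
     {(T, B). T \<in> regular_designs n k \<and>
        B \<in> carrier_mat (n - k) p \<and> vec_space.rank (n - k) B = p}"

text \<open>Coefficient vectors whose first nonzero entry exists and is \<open>1\<close>.\<close>

definition normalized_vecs :: "nat \<Rightarrow> 'a::field vec set" where
  "normalized_vecs p =
     {l \<in> carrier_vec p. \<exists>i<p. l $ i = 1 \<and> (\<forall>j<i. l $ j = 0)}"

text \<open>The order of the columns of \<open>F\<close> is immaterial and left to an arbitrary choice.\<close>

definition normalized_list :: "nat \<Rightarrow> 'a::{finite,field} vec list" where
  "normalized_list p = (SOME xs. distinct xs \<and> set xs = normalized_vecs p)"

definition block_matrix :: "'a::{finite,field} mat \<Rightarrow> 'a mat" where
  "block_matrix B =
     mat_of_cols (dim_row B) (map (\<lambda>l. B *\<^sub>v l) (normalized_list (dim_col B)))"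

definition L :: "'a::{finite,field} itself \<Rightarrow> nat \<Rightarrow> nat" where
  "L _ q = (CARD('a) ^ q - 1) div (CARD('a) - 1)"

lemma carrier_vec_Suc: "carrier_vec (Suc n) = (\<lambda>(a, v). vCons a v) ` (UNIV \<times> carrier_vec n)"
proof (intro Set.set_eqI iffI)
  fix v :: "'a vec" assume "v \<in> carrier_vec (Suc n)"
  then show "v \<in> (\<lambda>(a, v). vCons a v) ` (UNIV \<times> carrier_vec n)" by (cases v) auto
qed auto

lemma finite_card_carrier_vec:
  "finite (carrier_vec n :: 'a::finite vec set) \<and>
   card (carrier_vec n :: 'a vec set) = CARD('a) ^ n"
proof (induction n)
  case 0
  have "carrier_vec 0 = {vNil :: 'a vec}" by auto
  then show ?case by simp
next
  case (Suc n)
  have "inj_on (\<lambda>(a, v). vCons a v) (UNIV \<times> carrier_vec n :: ('a \<times> 'a vec) set)"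
    by (auto simp: inj_on_def)
  with Suc show ?case by (simp add: carrier_vec_Suc card_image card_cartesian_product)
qed

lemma normalized_vecs_Suc:
  "(normalized_vecs (Suc p) :: 'a::field vec set) =
     vCons 1 ` carrier_vec p \<union> vCons 0 ` normalized_vecs p"
proof (intro Set.set_eqI)
  fix v :: "'a vec"
  show "v \<in> normalized_vecs (Suc p) \<longleftrightarrow>
        v \<in> vCons 1 ` carrier_vec p \<union> vCons 0 ` normalized_vecs p"
  proof (cases v)
    case vNil
    then show ?thesis by (auto simp: normalized_vecs_def dest: arg_cong[where f = dim_vec])
  next
    case (vCons a w)
    have "(\<exists>i<Suc p. vCons a w $ i = 1 \<and> (\<forall>j<i. vCons a w $ j = 0)) \<longleftrightarrow>
          a = 1 \<or> a = 0 \<and> (\<exists>i<p. w $ i = 1 \<and> (\<forall>j<i. w $ j = 0))"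
      by (auto simp: ex_simps Ex_less_Suc2 All_less_Suc2)
    then show ?thesis using vCons by (auto simp: normalized_vecs_def)
  qed
qed

lemma finite_card_normalized_vecs:
  "finite (normalized_vecs p :: 'a::{finite,field} vec set) \<and>
   (CARD('a) - 1) * card (normalized_vecs p :: 'a vec set) = CARD('a) ^ p - 1"
proof (induction p)
  case 0
  then show ?case by (simp add: normalized_vecs_def)
next
  case (Suc p)
  let ?c = "CARD('a)" and ?N = "normalized_vecs p :: 'a vec set"
  have "card (vCons 1 ` carrier_vec p \<union> vCons 0 ` ?N) = ?c ^ p + card ?N"
    using Suc finite_card_carrier_vec[where 'a = 'a and n = p]
    by (subst card_Un_disjoint) (auto simp: card_image inj_on_def)
  then have "(?c - 1) * card (normalized_vecs (Suc p) :: 'a vec set) =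
      (?c - 1) * ?c ^ p + (?c ^ p - 1)"
    using Suc by (simp add: normalized_vecs_Suc distrib_left)
  also have "\<dots> = ?c ^ Suc p - 1"
  proof -
    have "?c ^ p \<ge> 1" "?c * ?c ^ p \<ge> ?c ^ p" by simp_all
    then show ?thesis by (simp add: diff_mult_distrib)
  qed
  finally show ?case
    using Suc finite_card_carrier_vec[where 'a = 'a and n = p]
    by (simp add: normalized_vecs_Suc)
qed

lemma card_field_ge_2: "CARD('a::{finite,field}) \<ge> 2"
proof -
  have "card {0, 1 :: 'a} \<le> CARD('a)" by (rule card_mono) auto
  then show ?thesis by simp
qed

lemma set_normalized_list:
  "distinct (normalized_list p :: 'a::{finite,field} vec list) \<and>
   set (normalized_list p :: 'a vec list) = normalized_vecs p"
  unfolding normalized_list_def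
  by (rule someI_ex) (use finite_distinct_list finite_card_normalized_vecs in blast)

lemma block_matrix_carrier:
  fixes B :: "'a::{finite,field} mat"
  assumes "B \<in> carrier_mat m p"
  shows "block_matrix B \<in> carrier_mat m (L TYPE('a) p)"
proof -
  have "length (normalized_list p :: 'a vec list) = card (normalized_vecs p :: 'a vec set)"
    using set_normalized_list[where 'a = 'a and p = p] by (metis distinct_card)
  also have "\<dots> = L TYPE('a) p"
    using finite_card_normalized_vecs[where 'a = 'a and p = p] card_field_ge_2[where 'a = 'a]
    unfolding L_def by (metis nonzero_mult_div_cancel_left not_numeral_le_zero One_nat_def
        Suc_1 Suc_leD diff_is_0_eq not_less_eq_eq)
  finally show ?thesis using assms by (auto simp: block_matrix_def)
qed

definition wt :: "'a::zero vec \<Rightarrow> nat" where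
  "wt w = card {j. j < dim_vec w \<and> w $ j \<noteq> 0}"

definition A0 :: "'a::{finite,field} mat \<Rightarrow> nat \<Rightarrow> real" where
  "A0 T i = inverse (of_nat CARD('a) - 1) *
     of_nat (card {w \<in> carrier_vec (dim_col T). T *\<^sub>v w = 0\<^sub>v (dim_row T) \<and> wt w = i})"

definition A1 :: "'a::{finite,field} mat \<times> 'a mat \<Rightarrow> nat \<Rightarrow> real" where
  "A1 = (\<lambda>(T, B) i. inverse (of_nat CARD('a) - 1) *
     of_nat (card {(w1, w2). w1 \<in> carrier_vec (dim_col T) \<and>
       w2 \<in> carrier_vec (L TYPE('a) (dim_col B)) \<and>
       T *\<^sub>v w1 + block_matrix B *\<^sub>v w2 = 0\<^sub>v (dim_row T) \<and> wt w1 = i \<and> wt w2 = 1}))"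

definition RME_designs :: "nat \<Rightarrow> nat \<Rightarrow> nat \<Rightarrow> ('a::{finite,field} mat \<times> 'a mat) set" where
  "RME_designs n k p =
     {D \<in> blocked_designs n k p. A0 (fst D) 1 = 0 \<and> A0 (fst D) 2 = 0 \<and> A1 D 1 = 0}"

text \<open>\<^const>\<open>less_fun\<close> is the strict lexicographic order on sequences.\<close>

definition lex_minimizes :: "('d \<Rightarrow> nat \<Rightarrow> real) \<Rightarrow> 'd set \<Rightarrow> 'd \<Rightarrow> bool" where
  "lex_minimizes W S D \<longleftrightarrow>
     D \<in> S \<and> (\<forall>D'\<in>S. W D = W D' \<or> less_fun (W D) (W D'))"

text \<open>
  All sequences are infinite: since \<open>A\<^bsub>i,0\<^esub>\<close> and \<open>A\<^bsub>i,1\<^esub>\<close> vanish for \<open>i > n\<close>, this only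
  pads the finite ones by zeros. Positions start at \<open>0\<close>; the pairs and triples are
  those for \<open>i = 2, 3, \<dots>\<close>.
\<close>

definition W_reg :: "'a::{finite,field} mat \<Rightarrow> nat \<Rightarrow> real" where
  "W_reg T j = A0 T (j + 1)"

definition W_scf :: "'a::{finite,field} mat \<times> 'a mat \<Rightarrow> nat \<Rightarrow> real" where
  "W_scf D j = (let i = j div 2 + 2 in [A0 (fst D) (i + 1), A1 D i] ! (j mod 2))"

definition W_cc :: "'a::{finite,field} mat \<times> 'a mat \<Rightarrow> nat \<Rightarrow> real" where
  "W_cc D j = (let i = j div 2 + 2 in
     [of_nat ((2 * i - 1) choose i) * A0 (fst D) (2 * i - 1) + A1 D i,
      A0 (fst D) (2 * i)] ! (j mod 2))"

definition W_1 :: "'a::{finite,field} mat \<times> 'a mat \<Rightarrow> nat \<Rightarrow> real" where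
  "W_1 D j = (let i = j div 3 + 2 in
     [A0 (fst D) (2 * i - 1), A0 (fst D) (2 * i), A1 D i] ! (j mod 3))"

definition W_2 :: "'a::{finite,field} mat \<times> 'a mat \<Rightarrow> nat \<Rightarrow> real" where
  "W_2 D j = (let i = j div 3 + 2 in
     [A0 (fst D) (2 * i - 1), A1 D i, A0 (fst D) (2 * i)] ! (j mod 3))"

end

theory Submission
  imports Defs
begin

text \<open>
  The theorem is a statement about lexicographic orders: \<open>D\<close> is compared with a competing RME design
  \<open>D'\<close> at the first position where a sequence tells them apart. Minimum aberration of \<open>D\<^sub>T\<close> says
  that the first \<open>A\<^bsub>t,0\<^esub>\<close> on which they differ is smaller for \<open>D\<close>, however the entries
  \<open>A\<^bsub>i,1\<^esub>\<close> behave. Minimality for \<open>W\<^bsub>scf\<^esub>\<close> says that \<open>A\<^bsub>i,1\<^esub>\<close> is smaller for \<open>D\<close> if it is the first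
  \<open>A\<^bsub>j,1\<^esub>\<close> to differ and \<open>A\<^bsub>3,0\<^esub>, \<dots>, A\<^bsub>i+1,0\<^esub>\<close> agree. These two facts are
  \<open>A0_le_at_first_difference\<close> and \<open>A1_le_at_first_difference\<close>.

  They settle every sequence that lists the \<open>A\<^bsub>t,0\<^esub>\<close> and the \<open>A\<^bsub>i,1\<^esub>\<close> in increasing order
  and in which \<open>A\<^bsub>i+1,0\<^esub>\<close> precedes \<open>A\<^bsub>i,1\<^esub>\<close> (\<open>lex_minimizes_interleaving\<close>). Both \<open>W\<^sub>1\<close>
  and \<open>W\<^sub>2\<close> are of this kind, because \<open>i + 1 \<le> 2i - 1\<close> for \<open>i \<ge> 2\<close>.

  In \<open>W\<^bsub>cc\<^esub>\<close> the entry for \<open>i\<close> mixes \<open>A\<^bsub>2i-1,0\<^esub>\<close> with \<open>A\<^bsub>i,1\<^esub>\<close>, so agreement of the entries up to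
  some position has to be turned into agreement of the single \<open>A\<close>'s. For \<open>i \<ge> 3\<close> the numbers
  \<open>A\<^bsub>3,0\<^esub>, \<dots>, A\<^bsub>2i-2,0\<^esub>\<close> already include \<open>A\<^bsub>i+1,0\<^esub>\<close>, hence both summands are at most those of
  \<open>D'\<close>, and equality of the sums forces equality of the summands. For \<open>i = 2\<close> the
  comparison of \<open>A\<^bsub>2,1\<^esub>\<close> would need \<open>A\<^bsub>3,0\<^esub>\<close> to agree, and the hypothesis on
  \<open>\<alpha>A\<^bsub>3,0\<^esub> + A\<^bsub>2,1\<^esub>\<close> takes its place: adding \<open>(3 - \<alpha>)A\<^bsub>3,0\<^esub>\<close>, which \<open>D\<close> minimizes too,
  shows that \<open>D\<close> minimizes \<open>3A\<^bsub>3,0\<^esub> + A\<^bsub>2,1\<^esub>\<close>. As \<open>3 - \<alpha> > 0\<close>, a tie forces a tie in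
  \<open>A\<^bsub>3,0\<^esub>\<close>, hence also one in \<open>A\<^bsub>2,1\<^esub>\<close>.
\<close>

section \<open>Lexicographic minimality by first differences\<close>

text \<open>
  Sequences over the natural numbers that differ have a least position where they differ, so the
  lexicographic order can be tested position by position. In this form minimality for one
  sequence can be carried over to another one entry at a time.
\<close>

lemma lex_minimizes_iff:
  "lex_minimizes W S D \<longleftrightarrow>
     D \<in> S \<and> (\<forall>D'\<in>S. \<forall>j. (\<forall>i<j. W D i = W D' i) \<longrightarrow> W D j \<le> W D' j)"
proof -
  have "f = g \<or> less_fun f g \<longleftrightarrow> (\<forall>j. (\<forall>i<j. f i = g i) \<longrightarrow> f j \<le> g j)"
    for f g :: "nat \<Rightarrow> real"
  proof
    assume "f = g \<or> less_fun f g"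
    then show "\<forall>j. (\<forall>i<j. f i = g i) \<longrightarrow> f j \<le> g j"
    proof
      assume "less_fun f g"
      then obtain l where l: "f l < g l" "\<And>i. i < l \<Longrightarrow> f i = g i"
        unfolding less_fun_def by blast
      show ?thesis
      proof (intro allI impI)
        fix j assume "\<forall>i<j. f i = g i"
        with l(1) have "\<not> l < j" by auto
        then show "f j \<le> g j" using l by (cases "j = l") auto
      qed
    qed simp
  next
    assume le: "\<forall>j. (\<forall>i<j. f i = g i) \<longrightarrow> f j \<le> g j"
    show "f = g \<or> less_fun f g"
    proof (cases "f = g")
      case False
      then have "\<exists>j. f j \<noteq> g j" by (simp add: fun_eq_iff)
      then obtain l where l: "f l \<noteq> g l" "\<And>i. i < l \<Longrightarrow> f i = g i"
        unfolding exists_least_iff[of "\<lambda>j. f j \<noteq> g j"] by blast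
      with le have "f l < g l" by (simp add: order_less_le)
      with l(2) have "less_fun f g" unfolding less_fun_def by blast
      then show ?thesis ..
    qed simp
  qed
  then show ?thesis unfolding lex_minimizes_def by simp
qed

lemma lex_minimizesD:
  assumes "lex_minimizes W S D" "D' \<in> S" "\<And>i. i < j \<Longrightarrow> W D i = W D' i"
  shows "W D j \<le> W D' j"
  using assms unfolding lex_minimizes_iff by blast

text \<open>
  The entries of the sequences, with the words of length three and the index \<open>i = 2\<close>
  at offset \<open>0\<close>.
\<close>

lemma W_reg_entries: "W_reg T (u + 2) = A0 T (u + 3)"
proof -
  have "u + 2 + 1 = u + 3" by simp
  then show ?thesis by (simp only: W_reg_def)
qed

lemma W_scf_entries:
  "W_scf D (2 * q) = A0 (fst D) (q + 3)"
  "W_scf D (2 * q + 1) = A1 D (q + 2)"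
  by (simp_all add: W_scf_def Let_def numeral_3_eq_3)

lemma W_1_entries:
  "W_1 D (3 * q) = A0 (fst D) (2 * q + 3)"
  "W_1 D (3 * q + 1) = A0 (fst D) (2 * q + 4)"
  "W_1 D (3 * q + 2) = A1 D (q + 2)"
proof -
  have nth: "[x, y, z] ! 0 = x" "[x, y, z] ! 1 = y" "[x, y, z] ! 2 = z" for x y z :: real
    by simp_all
  have "3 * q div 3 = q" "3 * q mod 3 = 0" "(3 * q + 1) div 3 = q" "(3 * q + 1) mod 3 = 1"
    "(3 * q + 2) div 3 = q" "(3 * q + 2) mod 3 = 2" by presburger+
  moreover have "2 * (q + 2) - 1 = 2 * q + 3" "2 * (q + 2) = 2 * q + 4" by presburger+
  ultimately show "W_1 D (3 * q) = A0 (fst D) (2 * q + 3)"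
    "W_1 D (3 * q + 1) = A0 (fst D) (2 * q + 4)"
    "W_1 D (3 * q + 2) = A1 D (q + 2)"
    by (simp_all only: W_1_def Let_def nth)
qed

lemma W_2_entries:
  "W_2 D (3 * q) = A0 (fst D) (2 * q + 3)"
  "W_2 D (3 * q + 1) = A1 D (q + 2)"
  "W_2 D (3 * q + 2) = A0 (fst D) (2 * q + 4)"
proof -
  have nth: "[x, y, z] ! 0 = x" "[x, y, z] ! 1 = y" "[x, y, z] ! 2 = z" for x y z :: real
    by simp_all
  have "3 * q div 3 = q" "3 * q mod 3 = 0" "(3 * q + 1) div 3 = q" "(3 * q + 1) mod 3 = 1"
    "(3 * q + 2) div 3 = q" "(3 * q + 2) mod 3 = 2" by presburger+
  moreover have "2 * (q + 2) - 1 = 2 * q + 3" "2 * (q + 2) = 2 * q + 4" by presburger+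
  ultimately show "W_2 D (3 * q) = A0 (fst D) (2 * q + 3)"
    "W_2 D (3 * q + 1) = A1 D (q + 2)"
    "W_2 D (3 * q + 2) = A0 (fst D) (2 * q + 4)"
    by (simp_all only: W_2_def Let_def nth)
qed

lemma W_cc_entries:
  "W_cc D (2 * q) =
     of_nat ((2 * q + 3) choose (q + 2)) * A0 (fst D) (2 * q + 3) + A1 D (q + 2)"
  "W_cc D (2 * q + 1) = A0 (fst D) (2 * q + 4)"
proof -
  have "2 * (q + 2) - 1 = 2 * q + 3" "2 * (q + 2) = 2 * q + 4"
    "2 * q div 2 = q" "2 * q mod 2 = 0" "(2 * q + 1) div 2 = q" "(2 * q + 1) mod 2 = 1"
    by presburger+
  then show "W_cc D (2 * q) =
     of_nat ((2 * q + 3) choose (q + 2)) * A0 (fst D) (2 * q + 3) + A1 D (q + 2)"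
    "W_cc D (2 * q + 1) = A0 (fst D) (2 * q + 4)"
    by (simp_all only: W_cc_def Let_def nth_Cons_0 nth_Cons_Suc One_nat_def)
qed

section \<open>What the two minimality hypotheses give\<close>

text \<open>
  RME designs share \<open>A\<^bsub>1,0\<^esub> = A\<^bsub>2,0\<^esub> = 0\<close>, so for them the comparison of treatment designs
  starts at words of length three.
\<close>

lemma A0_le_at_first_difference:
  fixes D D' :: "'a::{finite,field} mat \<times> 'a mat"
  assumes ma: "lex_minimizes W_reg (regular_designs n k) (fst D)"
    and D: "D \<in> RME_designs n k p" and D': "D' \<in> RME_designs n k p"
    and agree: "\<And>u. u < v \<Longrightarrow> A0 (fst D) (u + 3) = A0 (fst D') (u + 3)"
  shows "A0 (fst D) (v + 3) \<le> A0 (fst D') (v + 3)"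
proof -
  have reg: "fst D' \<in> regular_designs n k"
    using D' by (auto simp: RME_designs_def blocked_designs_def)
  have "W_reg (fst D) i = W_reg (fst D') i" if "i < v + 2" for i
  proof -
    have "i = 0 \<or> i = 1 \<or> i = (i - 2) + 2 \<and> i - 2 < v" using that by linarith
    then consider "i = 0" | "i = 1" | u where "i = u + 2" "u < v" by blast
    then show ?thesis
    proof cases
      case 3
      then show ?thesis by (simp only: W_reg_entries agree)
    qed (use D D' in \<open>simp_all add: W_reg_def RME_designs_def numeral_2_eq_2\<close>)
  qed
  then have "W_reg (fst D) (v + 2) \<le> W_reg (fst D') (v + 2)"
    by (rule lex_minimizesD[OF ma reg])
  then show ?thesis unfolding W_reg_entries .
qed

lemma A1_le_at_first_difference:
  assumes scf: "lex_minimizes W_scf S D" and D': "D' \<in> S"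
    and agree0: "\<And>u. u \<le> v \<Longrightarrow> A0 (fst D) (u + 3) = A0 (fst D') (u + 3)"
    and agree1: "\<And>u. u < v \<Longrightarrow> A1 D (u + 2) = A1 D' (u + 2)"
  shows "A1 D (v + 2) \<le> A1 D' (v + 2)"
proof -
  have "W_scf D i = W_scf D' i" if "i < 2 * v + 1" for i
  proof (cases "even i")
    case True
    then obtain u where u: "i = 2 * u" by (rule evenE)
    with that have "u \<le> v" by simp
    then show ?thesis unfolding u W_scf_entries by (rule agree0)
  next
    case False
    then obtain u where u: "i = 2 * u + 1" by (rule oddE)
    with that have "u < v" by simp
    then show ?thesis unfolding u W_scf_entries by (rule agree1)
  qed
  then have "W_scf D (2 * v + 1) \<le> W_scf D' (2 * v + 1)"
    by (rule lex_minimizesD[OF scf D'])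
  then show ?thesis unfolding W_scf_entries .
qed

section \<open>Sequences that interleave the two wordlength patterns\<close>

text \<open>
  The functions \<open>pos_treat\<close> and \<open>pos_block\<close> give the positions of the entries \<open>A\<^bsub>u+3,0\<^esub>\<close> and
  \<open>A\<^bsub>v+2,1\<^esub>\<close>. The condition \<open>pos_treat v < pos_block v\<close> puts \<open>A\<^bsub>i+1,0\<^esub>\<close> before \<open>A\<^bsub>i,1\<^esub>\<close>, so
  that whenever \<open>A\<^bsub>i,1\<^esub>\<close> is reached everything preceding it in \<open>W\<^bsub>scf\<^esub>\<close> is known to agree.
\<close>

lemma lex_minimizes_interleaving:
  assumes ma: "lex_minimizes W_reg (regular_designs n k) (fst D)"
    and scf: "lex_minimizes W_scf (RME_designs n k p) D"
    and W0: "\<And>E u. W E (pos_treat u) = A0 (fst E) (u + 3)"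
    and W1: "\<And>E v. W E (pos_block v) = A1 E (v + 2)"
    and mono0: "strict_mono pos_treat" and mono1: "strict_mono pos_block"
    and before: "\<And>v. pos_treat v < pos_block v"
    and cover: "\<And>j. j \<in> range pos_treat \<union> range pos_block"
  shows "lex_minimizes W (RME_designs n k p) D"
  unfolding lex_minimizes_iff
proof (intro conjI ballI allI impI)
  show D: "D \<in> RME_designs n k p" using scf by (simp add: lex_minimizes_def)
  fix D' j
  assume D': "D' \<in> RME_designs n k p" and eq: "\<forall>i<j. W D i = W D' i"
  have agree0: "A0 (fst D) (u + 3) = A0 (fst D') (u + 3)" if "pos_treat u < j" for u
    using eq that by (metis W0)
  have agree1: "A1 D (v + 2) = A1 D' (v + 2)" if "pos_block v < j" for v
    using eq that by (metis W1)
  from cover[of j] consider v where "j = pos_treat v" | v where "j = pos_block v" by auto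
  then show "W D j \<le> W D' j"
  proof cases
    case 1
    have "A0 (fst D) (v + 3) \<le> A0 (fst D') (v + 3)"
      by (rule A0_le_at_first_difference[OF ma D D'])
        (simp add: agree0 1 strict_monoD[OF mono0])
    then show ?thesis by (simp add: 1 W0)
  next
    case 2
    have "pos_treat u < j" if "u \<le> v" for u
      using that before[of v] strict_mono_less_eq[OF mono0, of u v] 2 by simp
    moreover have "pos_block u < j" if "u < v" for u
      using that 2 by (simp add: strict_monoD[OF mono1])
    ultimately have "A1 D (v + 2) \<le> A1 D' (v + 2)"
      by (intro A1_le_at_first_difference[OF scf D'] agree0 agree1)
    then show ?thesis by (simp add: 2 W1)
  qed
qed

lemma lex_minimizes_W_1:
  fixes D :: "'a::{finite,field} mat \<times> 'a mat"
  assumes ma: "lex_minimizes W_reg (regular_designs n k) (fst D)"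
    and scf: "lex_minimizes W_scf (RME_designs n k p) D"
  shows "lex_minimizes W_1 (RME_designs n k p) D"
proof (rule lex_minimizes_interleaving[OF ma scf,
      where pos_treat = "\<lambda>u. 3 * (u div 2) + u mod 2" and pos_block = "\<lambda>v. 3 * v + 2"])
  fix E :: "'a mat \<times> 'a mat" and u :: nat
  show "W_1 E (3 * (u div 2) + u mod 2) = A0 (fst E) (u + 3)"
  proof (cases "even u")
    case True
    then obtain q where "u = 2 * q" by (rule evenE)
    then show ?thesis using W_1_entries(1)[of E q] by simp
  next
    case False
    then obtain q where "u = 2 * q + 1" by (rule oddE)
    then have "3 * (u div 2) + u mod 2 = 3 * q + 1" "u + 3 = 2 * q + 4" by presburger+
    then show ?thesis by (simp only: W_1_entries)
  qed
next
  fix j :: nat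
  have "\<exists>q. j = 3 * q \<or> j = 3 * q + 1 \<or> j = 3 * q + 2" by presburger
  then consider q where "j = 3 * q" | q where "j = 3 * q + 1" | q where "j = 3 * q + 2"
    by blast
  then show "j \<in> range (\<lambda>u. 3 * (u div 2) + u mod 2) \<union> range (\<lambda>v. 3 * v + 2)"
  proof cases
    case (1 q)
    then show ?thesis by (intro UnI1 range_eqI[of _ _ "2 * q"]) simp
  next
    case (2 q)
    then show ?thesis by (intro UnI1 range_eqI[of _ _ "2 * q + 1"]) simp
  qed blast
next
  show "strict_mono (\<lambda>u::nat. 3 * (u div 2) + u mod 2)"
    unfolding strict_mono_Suc_iff
  proof
    fix u :: nat
    show "3 * (u div 2) + u mod 2 < 3 * (Suc u div 2) + Suc u mod 2"
      by (cases "even u") (auto elim!: evenE oddE)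
  qed
next
  fix v :: nat
  show "3 * (v div 2) + v mod 2 < 3 * v + 2"
    using div_mult_mod_eq[of v 2] by linarith
next
  show "strict_mono (\<lambda>v::nat. 3 * v + 2)" by (simp add: strict_mono_def)
qed (rule W_1_entries)

lemma lex_minimizes_W_2:
  fixes D :: "'a::{finite,field} mat \<times> 'a mat"
  assumes ma: "lex_minimizes W_reg (regular_designs n k) (fst D)"
    and scf: "lex_minimizes W_scf (RME_designs n k p) D"
  shows "lex_minimizes W_2 (RME_designs n k p) D"
proof (rule lex_minimizes_interleaving[OF ma scf,
      where pos_treat = "\<lambda>u. 3 * (u div 2) + 2 * (u mod 2)" and pos_block = "\<lambda>v. 3 * v + 1"])
  fix E :: "'a mat \<times> 'a mat" and u :: nat
  show "W_2 E (3 * (u div 2) + 2 * (u mod 2)) = A0 (fst E) (u + 3)"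
  proof (cases "even u")
    case True
    then obtain q where "u = 2 * q" by (rule evenE)
    then show ?thesis using W_2_entries(1)[of E q] by simp
  next
    case False
    then obtain q where "u = 2 * q + 1" by (rule oddE)
    then have "3 * (u div 2) + 2 * (u mod 2) = 3 * q + 2" "u + 3 = 2 * q + 4" by presburger+
    then show ?thesis by (simp only: W_2_entries)
  qed
next
  fix j :: nat
  show "j \<in> range (\<lambda>u. 3 * (u div 2) + 2 * (u mod 2)) \<union> range (\<lambda>v. 3 * v + 1)"
  proof -
    have "\<exists>q. j = 3 * q \<or> j = 3 * q + 1 \<or> j = 3 * q + 2" by presburger
    then consider q where "j = 3 * q" | q where "j = 3 * q + 1" | q where "j = 3 * q + 2"
      by blast
    then show ?thesis
    proof cases
      case (1 q)
      then show ?thesis by (intro UnI1 range_eqI[of _ _ "2 * q"]) simp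
    next
      case (3 q)
      then show ?thesis by (intro UnI1 range_eqI[of _ _ "2 * q + 1"]) simp
    qed blast
  qed
next
  show "strict_mono (\<lambda>u::nat. 3 * (u div 2) + 2 * (u mod 2))"
    unfolding strict_mono_Suc_iff
  proof
    fix u :: nat
    show "3 * (u div 2) + 2 * (u mod 2) < 3 * (Suc u div 2) + 2 * (Suc u mod 2)"
      by (cases "even u") (auto elim!: evenE oddE)
  qed
next
  fix v :: nat
  show "3 * (v div 2) + 2 * (v mod 2) < 3 * v + 1"
    using div_mult_mod_eq[of v 2] by linarith
next
  show "strict_mono (\<lambda>v::nat. 3 * v + 1)" by (simp add: strict_mono_def)
qed (rule W_2_entries)

section \<open>The sequence with combined entries\<close>

text \<open>
  The point is to separate the combined entries: once all entries before position \<open>2q\<close> agree,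
  so do the numbers they are made of. The hypothesis \<open>first\<close> starts this induction, since for
  \<open>i = 2\<close> the number \<open>A\<^bsub>i+1,0\<^esub> = A\<^bsub>3,0\<^esub>\<close> is itself part of the entry and not known to agree.
\<close>

lemma lex_minimizes_W_cc:
  fixes D :: "'a::{finite,field} mat \<times> 'a mat"
  assumes ma: "lex_minimizes W_reg (regular_designs n k) (fst D)"
    and scf: "lex_minimizes W_scf (RME_designs n k p) D"
    and \<alpha>: "\<alpha> < 3"
    and first: "\<And>D' :: 'a mat \<times> 'a mat. D' \<in> RME_designs n k p \<Longrightarrow>
      \<alpha> * A0 (fst D) 3 + A1 D 2 \<le> \<alpha> * A0 (fst D') 3 + A1 D' 2"
  shows "lex_minimizes W_cc (RME_designs n k p) D"
  unfolding lex_minimizes_iff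
proof (intro conjI ballI allI impI)
  show D: "D \<in> RME_designs n k p" using scf by (simp add: lex_minimizes_def)
  fix D' :: "'a mat \<times> 'a mat" and j
  assume D': "D' \<in> RME_designs n k p" and eq: "\<forall>i<j. W_cc D i = W_cc D' i"
  define eq0 where "eq0 u \<longleftrightarrow> A0 (fst D) (u + 3) = A0 (fst D') (u + 3)" for u
  define eq1 where "eq1 v \<longleftrightarrow> A1 D (v + 2) = A1 D' (v + 2)" for v
  have le0: "A0 (fst D) (v + 3) \<le> A0 (fst D') (v + 3)" if "\<And>u. u < v \<Longrightarrow> eq0 u" for v
    using A0_le_at_first_difference[OF ma D D'] that unfolding eq0_def by blast
  have combined: "W_cc D (2 * q) \<le> W_cc D' (2 * q) \<and>
      (W_cc D (2 * q) = W_cc D' (2 * q) \<longrightarrow> eq0 (2 * q) \<and> eq1 q)"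
    if agree0: "\<And>u. u < 2 * q \<Longrightarrow> eq0 u" and agree1: "\<And>v. v < q \<Longrightarrow> eq1 v" for q
  proof (cases "q = 0")
    case True
    let ?d = "A0 (fst D') 3 - A0 (fst D) 3"
    have "?d \<ge> 0" using le0[of 0] by simp
    then have "(3 - \<alpha>) * ?d \<ge> 0" "(3 - \<alpha>) * ?d = 0 \<longleftrightarrow> ?d = 0" using \<alpha> by simp_all
    then have "3 * A0 (fst D) 3 + A1 D 2 \<le> 3 * A0 (fst D') 3 + A1 D' 2"
      "3 * A0 (fst D) 3 + A1 D 2 = 3 * A0 (fst D') 3 + A1 D' 2 \<Longrightarrow>
        A0 (fst D) 3 = A0 (fst D') 3"
      using first[OF D'] by (simp_all add: left_diff_distrib right_diff_distrib)
    moreover have "W_cc E (2 * q) = 3 * A0 (fst E) 3 + A1 E 2" for E :: "'a mat \<times> 'a mat"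
    proof -
      show ?thesis unfolding W_cc_entries True by (simp add: eval_nat_numeral)
    qed
    ultimately show ?thesis using True by (auto simp: eq0_def eq1_def numeral_2_eq_2)
  next
    case False
    let ?c = "real ((2 * q + 3) choose (q + 2))"
    have "?c > 0" by simp
    moreover have "A0 (fst D) (2 * q + 3) \<le> A0 (fst D') (2 * q + 3)"
      by (rule le0) (rule agree0)
    ultimately have "?c * A0 (fst D) (2 * q + 3) \<le> ?c * A0 (fst D') (2 * q + 3)"
      by (intro mult_left_mono) simp_all
    moreover have "A1 D (q + 2) \<le> A1 D' (q + 2)"
      \<comment> \<open>\<open>q \<ge> 1\<close> gives \<open>q < 2q\<close>, so \<open>A\<^bsub>q+3,0\<^esub>\<close> is among the numbers known to agree\<close>
      by (rule A1_le_at_first_difference[OF scf D'])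
        (use False agree0 agree1 in \<open>auto simp: eq0_def eq1_def\<close>)
    ultimately have "W_cc D (2 * q) \<le> W_cc D' (2 * q)"
      "W_cc D (2 * q) = W_cc D' (2 * q) \<Longrightarrow>
        ?c * A0 (fst D) (2 * q + 3) = ?c * A0 (fst D') (2 * q + 3) \<and>
        A1 D (q + 2) = A1 D' (q + 2)"
      unfolding W_cc_entries by linarith+
    then show ?thesis
      using \<open>?c > 0\<close> unfolding eq0_def eq1_def by simp
  qed
  have separated: "(\<forall>u<2 * q. eq0 u) \<and> (\<forall>v<q. eq1 v)" if "2 * q \<le> j" for q
    using that
  proof (induction q)
    case (Suc q)
    then have IH: "\<And>u. u < 2 * q \<Longrightarrow> eq0 u" "\<And>v. v < q \<Longrightarrow> eq1 v" by simp_all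
    from Suc.prems eq have "W_cc D (2 * q) = W_cc D' (2 * q)"
      "W_cc D (2 * q + 1) = W_cc D' (2 * q + 1)" by simp_all
    moreover have "2 * q + 1 + 3 = 2 * q + 4" by simp
    ultimately have "eq0 (2 * q + 1)" unfolding eq0_def by (simp only: W_cc_entries)
    moreover have "eq0 (2 * q)" "eq1 q"
      using combined[of q] IH \<open>W_cc D (2 * q) = W_cc D' (2 * q)\<close> by simp_all
    ultimately show ?case using IH by (auto simp: less_Suc_eq)
  qed simp
  show "W_cc D j \<le> W_cc D' j"
  proof (cases "even j")
    case True
    then obtain q where q: "j = 2 * q" by (rule evenE)
    then show ?thesis using combined[of q] separated[of q] by simp
  next
    case False
    then obtain q where q: "j = 2 * q + 1" by (rule oddE)
    then have agree: "\<And>u. u < 2 * q \<Longrightarrow> eq0 u" "\<And>v. v < q \<Longrightarrow> eq1 v"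
      using separated[of q] by simp_all
    moreover have "W_cc D (2 * q) = W_cc D' (2 * q)" using eq q by simp
    ultimately have "eq0 (2 * q)" using combined[of q] by blast
    with agree have "A0 (fst D) (2 * q + 1 + 3) \<le> A0 (fst D') (2 * q + 1 + 3)"
      by (intro le0) (auto simp: less_Suc_eq)
    then show ?thesis unfolding q W_cc_entries by (simp add: eval_nat_numeral)
  qed
qed

section \<open>The three minimum aberration criteria\<close>

theorem theorem7:
  fixes n k p :: nat
    and T B :: "'a::{finite,field} mat"
  assumes "n \<ge> 1" and "k < n" and "p \<ge> 1"
    and "(T, B) \<in> RME_designs n k p"
    and "lex_minimizes W_reg (regular_designs n k) T"
    and "lex_minimizes W_scf (RME_designs n k p) (T, B)"
  shows "lex_minimizes W_1 (RME_designs n k p) (T, B) \<and>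
    lex_minimizes W_2 (RME_designs n k p) (T, B) \<and>
    ((\<exists>\<alpha>::real. 0 \<le> \<alpha> \<and> \<alpha> < 3 \<and>
        is_arg_min (\<lambda>D. \<alpha> * A0 (fst D) 3 + A1 D 2) (\<lambda>D. D \<in> RME_designs n k p) (T, B)) \<longrightarrow>
      lex_minimizes W_cc (RME_designs n k p) (T, B))"
proof -
  have ma: "lex_minimizes W_reg (regular_designs n k) (fst (T, B))" using assms(5) by simp
  note scf = assms(6)
  show ?thesis
    using lex_minimizes_W_1[OF ma scf] lex_minimizes_W_2[OF ma scf]
      lex_minimizes_W_cc[OF ma scf]
    by (auto simp: is_arg_min_linorder)
qed

end
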